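(* Let $d\ge 2$, let $n_1,\ldots,n_d,n,a,b$ be positive integers, and let $\Theta=(\pi_1,\ldots,\pi_d,\mathrm{Id})\in\mathfrak{I}_{n_1,\ldots,n_d,n}$ be a feasible principal isotopism. Then Alice wins (i.e. has a winning strategy in) the $\Theta$-stabilized $(a,b)$-colouring game on the Hamming graph $\mathcal{H}_{n_1,\ldots,n_d}$ if and only if she wins the corresponding modified $(a,b)$-colouring game on the orbit contraction graph $\mathcal{H}_{n_1,\ldots,n_d}^{\Theta}$ (both games being played with the same number $n'\ge n$ of colours and the same starting player).
   Context: For a positive integer $m$, $[m]=\{1,\ldots,m\}$ and $S_m$ is the symmetric group on $[m]$. $\mathfrak{I}_{n_1,\ldots,n_d,n}=S_{n_1}\times\cdots\times S_{n_d}\times S_n$; its elements are called isotopisms; $(\pi_1,\ldots,\pi_d,\pi)$ is principal if $\pi=\mathrm{Id}$. For a permutation $\pi$, $l_{\pi,s}$ is the length of the cycle of $\pi$ containing $s$ and $\lambda^{\pi}_{l}$ is the number of cycles of length $l$ of $\pi$. A $k$-tuple of positive integers is lcm-compatible if the least common multiple of any $k-1$ of its entries equals the least common multiple of all $k$ entries; $\mathcal{C}_k$ is the set of lcm-compatible $k$-tuples. $\Theta=(\pi_1,\ldots,\pi_d,\pi)$ is feasible if $(l_1,\ldots,l_d,\ell)\in\mathcal{C}_{d+1}$ for every $(l_1,\ldots,l_d,\ell)\in[n_1]\times\cdots\times[n_d]\times[n]$ with $\lambda^{\pi}_{\ell}\prod_{j}\lambda^{\pi_j}_{l_j}>0$.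 The natural extension of $\Theta$ of size $n'\ge n$ is $\Theta'=(\pi_1,\ldots,\pi_d,\pi')\in\mathfrak{I}_{n_1,\ldots,n_d,n'}$ with $\pi'(s)=\pi(s)$ for $s\le n$ and $\pi'(s)=s$ for $n<s\le n'$. The Hamming graph $\mathcal{H}_{n_1,\ldots,n_d}=K_{n_1}\Box\cdots\Box K_{n_d}$ has vertices (cells) $[n_1]\times\cdots\times[n_d]$, two of them being adjacent (collinear) iff they differ in exactly one coordinate. A partial Latin hyper-rectangle $P$ based on $[n']$ is a partial colouring of these cells by symbols of $[n']$ in which collinear non-empty cells carry different symbols (Latin array condition). The cell orbits of $\Theta$ are the sets $\{(\pi_1^m(i_1),\ldots,\pi_d^m(i_d)) : m\in\mathbb{N}\}$. $P$ is $\Theta'$-compatible if for every non-empty cell $(i_1,\ldots,i_d)$: $(l_{\pi_1,i_1},\ldots,l_{\pi_d,i_d},l_{\pi',P(i_1,\ldots,i_d)})\in\mathcal{C}_{d+1}$, and for every positive integer $m$ the cell $(\pi_1^m(i_1),\ldots,\pi_d^m(i_d))$ is either empty or contains $(\pi')^m(P(i_1,\ldots,i_d))$. $\Theta$-stabilized $(a,b)$-colouring game with $n'$ colours: starting from the empty array, Alice and Bob alternately move; a move of Alice (Bob) consists of $\min\{a,u\}$ (resp. $\min\{b,u\}$) successive turns, where $u$ is the number of empty cells before the move. In a turn an empty cell $(i_1,\ldots,i_d)$ receives a symbol $s\in[n']$ such that: (Rule 1) the Latin array condition holds afterwards; (Rule 2) the resulting array is $\Theta'$-compatible; (Rule 3)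 for each positive integer $m<\mathrm{lcm}(l_{\pi_1,i_1},\ldots,l_{\pi_d,i_d})$ and each coloured cell $(i_1',\ldots,i_d')$ collinear with $(\pi_1^m(i_1),\ldots,\pi_d^m(i_d))$, $P(i_1',\ldots,i_d')\ne(\pi')^m(s)$. Alice wins if all cells are coloured at the end; otherwise Bob wins. The orbit contraction graph $\mathcal{H}^{\Theta}_{n_1,\ldots,n_d}$ is the vertex-weighted graph whose vertices are the cell orbits of $\Theta$; two distinct orbits are adjacent iff some cell of one is adjacent in $\mathcal{H}_{n_1,\ldots,n_d}$ to some cell of the other; the weight $\omega(v)$ of a vertex is the cardinality of the orbit. Modified $(a,b)$-colouring game on a vertex-weighted graph with $n'$ colours: Alice and Bob alternate as before, making $a$, respectively $b$, turns per move (or as many as remain possible, i.e. the total remaining weight, if that is less). Each turn is one of: (1) colour an uncoloured vertex $v$ with one of the $n'$ colours different from the colours of its neighbours, and replace $\omega(v)$ by $\omega(v)-1$; (2) for an already coloured vertex $v$ with $\omega(v)>0$, replace $\omega(v)$ by $\omega(v)-1$. Alice wins if every vertex is coloured at the end of the game; otherwise Bob wins. *)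

theory Defs
  imports "HOL-Combinatorics.Combinatorics"
begin

definition cycle_length :: "(nat \<Rightarrow> nat) \<Rightarrow> nat \<Rightarrow> nat" where
  "cycle_length p s = card (orbit p s)"

text \<open>The number \<open>\<lambda>\<^sup>p\<^sub>l\<close> of cycles of length \<open>l\<close> of the permutation \<open>p\<close> of \<open>{1..m}\<close>;
  fixed points count as cycles of length 1.\<close>

definition num_cycles :: "nat \<Rightarrow> (nat \<Rightarrow> nat) \<Rightarrow> nat \<Rightarrow> nat" where
  "num_cycles m p l = card {C. (\<exists>s\<in>{1..m}. C = orbit p s) \<and> card C = l}"

text \<open>Tuples are lists, so coordinate \<open>j\<close> of the literature is entry \<open>j - 1\<close> here.
  The set \<open>cells [n\<^sub>1, \<dots>, n\<^sub>d]\<close> is \<open>[n\<^sub>1] \<times> \<dots> \<times> [n\<^sub>d]\<close>.\<close>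

type_synonym cell = "nat list"

definition cells :: "nat list \<Rightarrow> cell set" where
  "cells ns = {c. length c = length ns \<and> (\<forall>j<length ns. c ! j \<in> {1..ns ! j})}"

text \<open>The pair \<open>([\<pi>\<^sub>1, \<dots>, \<pi>\<^sub>d], \<pi>)\<close> represents \<open>(\<pi>\<^sub>1, \<dots>, \<pi>\<^sub>d, \<pi>)\<close>.\<close>

type_synonym isotopism = "(nat \<Rightarrow> nat) list \<times> (nat \<Rightarrow> nat)"

definition isotopisms :: "nat list \<Rightarrow> nat \<Rightarrow> isotopism set" where
  "isotopisms ns n = {(ps, p). length ps = length ns \<and>
     (\<forall>j<length ns. (ps ! j) permutes {1..ns ! j}) \<and> p permutes {1..n}}"

definition principal :: "isotopism \<Rightarrow> bool" where
  "principal \<Theta> \<longleftrightarrow> snd \<Theta> = id"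

definition lcm_compatible :: "nat list \<Rightarrow> bool" where
  "lcm_compatible ls \<longleftrightarrow> (\<forall>l\<in>set ls. l > 0) \<and>
     (\<forall>i<length ls. (LCM j\<in>{..<length ls} - {i}. ls ! j) = (LCM j\<in>{..<length ls}. ls ! j))"

definition feasible :: "nat list \<Rightarrow> nat \<Rightarrow> isotopism \<Rightarrow> bool" where
  "feasible ns n \<Theta> \<longleftrightarrow> (\<forall>ls\<in>cells ns. \<forall>l\<in>{1..n}.
     num_cycles n (snd \<Theta>) l * (\<Prod>j<length ns. num_cycles (ns ! j) (fst \<Theta> ! j) (ls ! j)) > 0
       \<longrightarrow> lcm_compatible (ls @ [l]))"

definition natural_extension :: "nat \<Rightarrow> isotopism \<Rightarrow> isotopism" where
  "natural_extension n \<Theta> = (fst \<Theta>, \<lambda>s. if s \<le> n then snd \<Theta> s else s)"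

definition shift :: "isotopism \<Rightarrow> nat \<Rightarrow> cell \<Rightarrow> cell" where
  "shift \<Theta> m c = map2 (\<lambda>p i. (p ^^ m) i) (fst \<Theta>) c"

definition cell_orbit :: "isotopism \<Rightarrow> cell \<Rightarrow> cell set" where
  "cell_orbit \<Theta> c = range (\<lambda>m. shift \<Theta> m c)"

definition cell_cycle_lengths :: "isotopism \<Rightarrow> cell \<Rightarrow> nat list" where
  "cell_cycle_lengths \<Theta> c = map2 cycle_length (fst \<Theta>) c"

record 'v graph =
  verts :: "'v set"
  adj :: "'v \<Rightarrow> 'v \<Rightarrow> bool"

record 'v weighted_graph = "'v graph" +
  weight :: "'v \<Rightarrow> nat"

definition hamming_graph :: "nat list \<Rightarrow> cell graph" where
  "hamming_graph ns = \<lparr>verts = cells ns,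
     adj = (\<lambda>c c'. c \<in> cells ns \<and> c' \<in> cells ns \<and> card {j. j < length ns \<and> c ! j \<noteq> c' ! j} = 1)\<rparr>"

definition orbit_contraction_graph :: "nat list \<Rightarrow> isotopism \<Rightarrow> cell set weighted_graph" where
  "orbit_contraction_graph ns \<Theta> =
     \<lparr>verts = cell_orbit \<Theta> ` cells ns,
      adj = (\<lambda>A B. A \<in> cell_orbit \<Theta> ` cells ns \<and> B \<in> cell_orbit \<Theta> ` cells ns \<and> A \<noteq> B \<and>
              (\<exists>c\<in>A. \<exists>c'\<in>B. adj (hamming_graph ns) c c')),
      weight = card\<rparr>"

datatype player = Alice | Bob

fun opponent :: "player \<Rightarrow> player" where
  "opponent Alice = Bob"
| "opponent Bob = Alice"

fun quota :: "nat \<Rightarrow> nat \<Rightarrow> player \<Rightarrow> nat" where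
  "quota a b Alice = a"
| "quota a b Bob = b"

text \<open>\<open>turn\<close> says which boards a single turn may lead to (the same for both players),
  \<open>remaining\<close> is the upper bound on the number of turns in a move, and \<open>completed\<close> tells whether
  Alice wins when the game ends on the given board.\<close>

record 'p game =
  start :: 'p
  turn :: "'p \<Rightarrow> 'p \<Rightarrow> bool"
  remaining :: "'p \<Rightarrow> nat"
  completed :: "'p \<Rightarrow> bool"

text \<open>A position consists of a board, the player to move, and the number of turns left in the
  current move of that player. The game ends as soon as no legal turn exists.\<close>

type_synonym 'p position = "'p \<times> player \<times> nat"

definition new_move :: "'p game \<Rightarrow> nat \<Rightarrow> nat \<Rightarrow> player \<Rightarrow> 'p \<Rightarrow> 'p position" where
  "new_move G a b pl x = (x, pl, min (quota a b pl) (remaining G x))"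

inductive legal :: "'p game \<Rightarrow> nat \<Rightarrow> nat \<Rightarrow> 'p position \<Rightarrow> 'p position \<Rightarrow> bool"
  for G a b where
  same_move: "turn G x y \<Longrightarrow> k > 1 \<Longrightarrow> legal G a b (x, pl, k) (y, pl, k - 1)"
| end_move: "turn G x y \<Longrightarrow> legal G a b (x, pl, 1) (new_move G a b (opponent pl) y)"

definition is_play :: "'p game \<Rightarrow> nat \<Rightarrow> nat \<Rightarrow> player \<Rightarrow> 'p position list \<Rightarrow> bool" where
  "is_play G a b pl h \<longleftrightarrow> h \<noteq> [] \<and> hd h = new_move G a b pl (start G) \<and>
     (\<forall>i. Suc i < length h \<longrightarrow> legal G a b (h ! i) (h ! Suc i))"

definition game_over :: "'p game \<Rightarrow> nat \<Rightarrow> nat \<Rightarrow> 'p position \<Rightarrow> bool" where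
  "game_over G a b q \<longleftrightarrow> (\<nexists>r. legal G a b q r)"

definition alice_to_move :: "'p position \<Rightarrow> bool" where
  "alice_to_move q \<longleftrightarrow> fst (snd q) = Alice"

text \<open>A strategy of Alice maps the history of the play, up to and including the current
  position, to the position after her next turn.\<close>

type_synonym 'p strategy = "'p position list \<Rightarrow> 'p position"

definition is_strategy :: "'p game \<Rightarrow> nat \<Rightarrow> nat \<Rightarrow> player \<Rightarrow> 'p strategy \<Rightarrow> bool" where
  "is_strategy G a b pl \<sigma> \<longleftrightarrow>
     (\<forall>h. is_play G a b pl h \<and> alice_to_move (last h) \<and> \<not> game_over G a b (last h)
        \<longrightarrow> legal G a b (last h) (\<sigma> h))"

definition follows :: "'p strategy \<Rightarrow> 'p position list \<Rightarrow> bool" where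
  "follows \<sigma> h \<longleftrightarrow>
     (\<forall>i. Suc i < length h \<and> alice_to_move (h ! i) \<longrightarrow> h ! Suc i = \<sigma> (take (Suc i) h))"

text \<open>In the two games below every turn lowers \<open>remaining\<close>, so there are no infinite
  plays to account for.\<close>

definition winning_strategy :: "'p game \<Rightarrow> nat \<Rightarrow> nat \<Rightarrow> player \<Rightarrow> 'p strategy \<Rightarrow> bool" where
  "winning_strategy G a b pl \<sigma> \<longleftrightarrow> is_strategy G a b pl \<sigma> \<and>
     (\<forall>h. is_play G a b pl h \<and> follows \<sigma> h \<and> game_over G a b (last h)
        \<longrightarrow> completed G (fst (last h)))"

definition alice_wins :: "'p game \<Rightarrow> nat \<Rightarrow> nat \<Rightarrow> player \<Rightarrow> bool" where
  "alice_wins G a b pl \<longleftrightarrow> (\<exists>\<sigma>. winning_strategy G a b pl \<sigma>)"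

type_synonym array = "cell \<rightharpoonup> nat"

definition latin_array :: "nat list \<Rightarrow> array \<Rightarrow> bool" where
  "latin_array ns P \<longleftrightarrow>
     (\<forall>c\<in>dom P. \<forall>c'\<in>dom P. adj (hamming_graph ns) c c' \<longrightarrow> P c \<noteq> P c')"

definition compatible :: "isotopism \<Rightarrow> array \<Rightarrow> bool" where
  "compatible \<Theta> P \<longleftrightarrow> (\<forall>c s. P c = Some s \<longrightarrow>
     lcm_compatible (cell_cycle_lengths \<Theta> c @ [cycle_length (snd \<Theta>) s]) \<and>
     (\<forall>m>0. P (shift \<Theta> m c) = None \<or> P (shift \<Theta> m c) = Some ((snd \<Theta> ^^ m) s)))"

definition no_future_conflict :: "nat list \<Rightarrow> isotopism \<Rightarrow> array \<Rightarrow> cell \<Rightarrow> nat \<Rightarrow> bool" where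
  "no_future_conflict ns \<Theta> P c s \<longleftrightarrow>
     (\<forall>m. 0 < m \<and> m < Lcm (set (cell_cycle_lengths \<Theta> c)) \<longrightarrow>
        (\<forall>c'\<in>dom P. adj (hamming_graph ns) c' (shift \<Theta> m c) \<longrightarrow> P c' \<noteq> Some ((snd \<Theta> ^^ m) s)))"

text \<open>Here \<open>\<Theta>\<close> is an isotopism in \<open>isotopisms ns n\<close>, and the rules refer to its natural extension
  \<open>\<Theta>'\<close> of size \<open>n'\<close>.\<close>

definition stabilized_game :: "nat list \<Rightarrow> nat \<Rightarrow> isotopism \<Rightarrow> nat \<Rightarrow> array game" where
  "stabilized_game ns n \<Theta> n' = (let \<Theta>' = natural_extension n \<Theta> in
     \<lparr>start = Map.empty,
      turn = (\<lambda>P Q. \<exists>c\<in>cells ns. \<exists>s\<in>{1..n'}. P c = None \<and> Q = P(c \<mapsto> s) \<and>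
                latin_array ns Q \<and> compatible \<Theta>' Q \<and> no_future_conflict ns \<Theta>' Q c s),
      remaining = (\<lambda>P. card {c\<in>cells ns. P c = None}),
      completed = (\<lambda>P. \<forall>c\<in>cells ns. P c \<noteq> None)\<rparr>)"

text \<open>A board is a partial colouring together with the current weights. An uncoloured vertex still
  has its original weight, which is positive in an orbit contraction graph, so the truncated
  subtraction is harmless.\<close>

inductive modified_turn ::
  "('v, 'z) weighted_graph_scheme \<Rightarrow> nat \<Rightarrow> ('v \<rightharpoonup> nat) \<times> ('v \<Rightarrow> nat) \<Rightarrow> ('v \<rightharpoonup> nat) \<times> ('v \<Rightarrow> nat) \<Rightarrow> bool"
  for H n' where
  colour_vertex: "v \<in> verts H \<Longrightarrow> f v = None \<Longrightarrow> s \<in> {1..n'} \<Longrightarrow>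
     (\<And>u. u \<in> verts H \<Longrightarrow> adj H v u \<Longrightarrow> f u \<noteq> Some s) \<Longrightarrow>
     modified_turn H n' (f, \<omega>) (f(v \<mapsto> s), \<omega>(v := \<omega> v - 1))"
| reduce_weight: "v \<in> verts H \<Longrightarrow> f v \<noteq> None \<Longrightarrow> \<omega> v > 0 \<Longrightarrow>
     modified_turn H n' (f, \<omega>) (f, \<omega>(v := \<omega> v - 1))"

definition modified_game ::
  "('v, 'z) weighted_graph_scheme \<Rightarrow> nat \<Rightarrow> (('v \<rightharpoonup> nat) \<times> ('v \<Rightarrow> nat)) game" where
  "modified_game H n' =
     \<lparr>start = (Map.empty, weight H),
      turn = modified_turn H n',
      remaining = (\<lambda>(f, \<omega>). \<Sum>v\<in>verts H. \<omega> v),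
      completed = (\<lambda>(f, \<omega>). \<forall>v\<in>verts H. f v \<noteq> None)\<rparr>"

end

theory Submission
  imports Defs
begin

text \<open>The two games are bisimilar, and bisimilar games have the same winner. An array \<open>P\<close> of the
  stabilized game is matched with the board \<open>(f, \<omega>)\<close> of the modified game in which an orbit carries
  the symbol common to its coloured cells and has as weight the number of its empty cells. Filling
  an empty cell then corresponds to colouring its orbit, if that orbit is still uncoloured, and
  merely to lowering the weight of the orbit otherwise.

  Three facts make the correspondence exact.

  \<^item> Since symbols are fixed by the identity, compatibility forces all coloured cells of an orbit to
    share one symbol.

  \<^item> Feasibility makes the cycle lengths \<open>(l\<^sub>1, \<dots>, l\<^sub>d, 1)\<close> of a cell lcm-compatible, so a shift that
    fixes all coordinates of the cell but one also fixes the last. Hence an orbit contains no two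
    collinear cells (\<open>shift_not_collinear\<close>), and using one symbol throughout an orbit never breaks
    the Latin condition inside it.

  \<^item> For the first cell of an orbit, the Latin condition together with Rule 3 says that no cell of
    the whole orbit is collinear with a cell carrying the symbol. Collinearity is invariant under
    the isotopism, so this excludes exactly the symbols of the adjacent orbits
    (\<open>stabilized_turn_contracts\<close>). Conversely, every array matched with a properly coloured board
    obeys all three rules, so each turn of the modified game can be realized
    (\<open>modified_turn_contracts\<close>).

  The winning conditions differ on general boards: a coloured orbit may still have empty cells. They
  are compared only when the game is over, and then no weight is left on a coloured orbit, since
  lowering it would be a legal turn.

  That bisimilar games have the same winner is shown by replacing strategies, which depend on the
  whole history, by the coinductive set of safe positions: those from which Alice can
  prevent the game from ending on a board that is not completed (\<open>alice_wins_iff_safe\<close>, \<open>alice_wins_bisimulation\<close>).\<close>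

section \<open>Winning without strategies, and bisimilar games\<close>

text \<open>Winning is a safety condition: Alice only has to avoid ending on a board that is not completed,
  and a play that never ends does her no harm. Hence the greatest set closed under these rules.\<close>

coinductive safe :: "'p game \<Rightarrow> nat \<Rightarrow> nat \<Rightarrow> 'p position \<Rightarrow> bool"
  for G a b where
  finished: "game_over G a b q \<Longrightarrow> completed G (fst q) \<Longrightarrow> safe G a b q"
| alice: "alice_to_move q \<Longrightarrow> legal G a b q r \<Longrightarrow> safe G a b r \<Longrightarrow> safe G a b q"
| bob: "\<not> alice_to_move q \<Longrightarrow> \<not> game_over G a b q \<Longrightarrow>
     (\<And>r. legal G a b q r \<Longrightarrow> safe G a b r) \<Longrightarrow> safe G a b q"

lemma safe_completed: "safe G a b q \<Longrightarrow> game_over G a b q \<Longrightarrow> completed G (fst q)"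
  by (erule safe.cases) (auto simp: game_over_def)

lemma safe_alice:
  "safe G a b q \<Longrightarrow> alice_to_move q \<Longrightarrow> \<not> game_over G a b q \<Longrightarrow>
     \<exists>r. legal G a b q r \<and> safe G a b r"
  by (erule safe.cases) auto

lemma safe_bob: "safe G a b q \<Longrightarrow> \<not> alice_to_move q \<Longrightarrow> legal G a b q r \<Longrightarrow> safe G a b r"
  by (erule safe.cases) (unfold game_over_def, blast+)

lemma safe_coinduct:
  assumes "X q"
    and "\<And>q. X q \<Longrightarrow> game_over G a b q \<Longrightarrow> completed G (fst q)"
    and "\<And>q. X q \<Longrightarrow> alice_to_move q \<Longrightarrow> \<not> game_over G a b q \<Longrightarrow> \<exists>r. legal G a b q r \<and> X r"
    and "\<And>q r. X q \<Longrightarrow> \<not> alice_to_move q \<Longrightarrow> legal G a b q r \<Longrightarrow> X r"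
  shows "safe G a b q"
  using assms(1)
proof (rule safe.coinduct)
  fix q assume X: "X q"
  show "(\<exists>q'. q = q' \<and> game_over G a b q' \<and> completed G (fst q')) \<or>
      (\<exists>q' r. q = q' \<and> alice_to_move q' \<and> legal G a b q' r \<and> (X r \<or> safe G a b r)) \<or>
      (\<exists>q'. q = q' \<and> \<not> alice_to_move q' \<and> \<not> game_over G a b q' \<and>
        (\<forall>r. legal G a b q' r \<longrightarrow> X r \<or> safe G a b r))"
  proof (cases "game_over G a b q")
    case True
    then show ?thesis using assms(2)[OF X] by simp
  next
    case False
    then show ?thesis
      using assms(3)[OF X] assms(4)[OF X] by (cases "alice_to_move q") metis+
  qed
qed

lemma is_play_snoc:
  assumes "is_play G a b pl h" "legal G a b (last h) r"
  shows "is_play G a b pl (h @ [r])"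
  unfolding is_play_def
proof (intro conjI allI impI)
  show "h @ [r] \<noteq> []" by simp
  show "hd (h @ [r]) = new_move G a b pl (start G)"
    using assms(1) by (auto simp: is_play_def)
  fix i assume i: "Suc i < length (h @ [r])"
  show "legal G a b ((h @ [r]) ! i) ((h @ [r]) ! Suc i)"
  proof (cases "Suc i < length h")
    case True
    then show ?thesis using assms(1) by (simp add: is_play_def nth_append)
  next
    case False
    with i have "length h = Suc i" by simp
    then show ?thesis using assms by (auto simp: is_play_def nth_append last_conv_nth)
  qed
qed

lemma follows_snoc:
  assumes "follows \<sigma> h" "h \<noteq> []" "alice_to_move (last h) \<Longrightarrow> r = \<sigma> h"
  shows "follows \<sigma> (h @ [r])"
  unfolding follows_def
proof (intro allI impI)
  fix i assume i: "Suc i < length (h @ [r]) \<and> alice_to_move ((h @ [r]) ! i)"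
  show "(h @ [r]) ! Suc i = \<sigma> (take (Suc i) (h @ [r]))"
  proof (cases "Suc i < length h")
    case True
    then show ?thesis using assms(1) i by (simp add: follows_def nth_append)
  next
    case False
    with i have "length h = Suc i" by simp
    then show ?thesis using assms(2,3) i by (auto simp: nth_append last_conv_nth)
  qed
qed

text \<open>From left to right, the positions reached by plays that follow the strategy are closed under the
  rules of \<^const>\<open>safe\<close>. From right to left, Alice moves to any safe position; plays that follow this
  memoryless strategy never leave the safe positions.\<close>

lemma alice_wins_iff_safe:
  "alice_wins G a b pl \<longleftrightarrow> safe G a b (new_move G a b pl (start G))"
proof
  assume "alice_wins G a b pl"
  then obtain \<sigma> where \<sigma>: "winning_strategy G a b pl \<sigma>" by (auto simp: alice_wins_def)
  have reached: "safe G a b q" if "\<exists>h. is_play G a b pl h \<and> follows \<sigma> h \<and> last h = q" for q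
    using that
  proof (rule safe_coinduct)
    fix q assume q: "\<exists>h. is_play G a b pl h \<and> follows \<sigma> h \<and> last h = q"
    then obtain h where h: "is_play G a b pl h" "follows \<sigma> h" "last h = q" by auto
    have ne: "h \<noteq> []" using h(1) by (simp add: is_play_def)
    have ext: "\<exists>h. is_play G a b pl h \<and> follows \<sigma> h \<and> last h = r"
      if "legal G a b q r" "alice_to_move q \<Longrightarrow> r = \<sigma> h" for r
      using is_play_snoc[OF h(1)] follows_snoc[OF h(2) ne] h(3) that
      by (intro exI[of _ "h @ [r]"]) auto
    show "completed G (fst q)" if "game_over G a b q"
      using \<sigma> h that by (auto simp: winning_strategy_def)
    show "\<exists>r. legal G a b q r \<and> (\<exists>h. is_play G a b pl h \<and> follows \<sigma> h \<and> last h = r)"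
      if "alice_to_move q" "\<not> game_over G a b q"
    proof -
      have "legal G a b q (\<sigma> h)"
        using \<sigma> h that by (auto simp: winning_strategy_def is_strategy_def)
      then show ?thesis using ext by blast
    qed
    show "\<exists>h. is_play G a b pl h \<and> follows \<sigma> h \<and> last h = r"
      if "\<not> alice_to_move q" "legal G a b q r" for r
      using ext that by blast
  qed
  show "safe G a b (new_move G a b pl (start G))"
    by (rule reached, rule exI[of _ "[new_move G a b pl (start G)]"])
      (simp add: is_play_def follows_def)
next
  assume safe0: "safe G a b (new_move G a b pl (start G))"
  \<comment> \<open>A strategy must give a legal answer even to histories that have already left the safe
    positions; this is the second branch.\<close>
  define \<sigma> where "\<sigma> h = (if \<exists>r. legal G a b (last h) r \<and> safe G a b r
      then SOME r. legal G a b (last h) r \<and> safe G a b r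
      else SOME r. legal G a b (last h) r)" for h
  have \<sigma>_safe: "legal G a b (last h) (\<sigma> h) \<and> safe G a b (\<sigma> h)"
    if "\<exists>r. legal G a b (last h) r \<and> safe G a b r" for h
    using someI_ex[OF that] that by (simp add: \<sigma>_def)
  have "legal G a b (last h) (\<sigma> h)" if "\<not> game_over G a b (last h)" for h
  proof (cases "\<exists>r. legal G a b (last h) r \<and> safe G a b r")
    case False
    have "\<exists>r. legal G a b (last h) r" using that by (simp add: game_over_def)
    from someI_ex[OF this] show ?thesis unfolding \<sigma>_def if_not_P[OF False] .
  qed (use \<sigma>_safe in blast)
  then have strat: "is_strategy G a b pl \<sigma>" by (simp add: is_strategy_def)
  have all_safe: "safe G a b (h ! i)" if h: "is_play G a b pl h" "follows \<sigma> h" and "i < length h" for h i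
    using that(3)
  proof (induction i)
    case 0
    then show ?case using safe0 h(1) by (auto simp: is_play_def hd_conv_nth)
  next
    case (Suc i)
    then have IH: "safe G a b (h ! i)" by simp
    have leg: "legal G a b (h ! i) (h ! Suc i)" using h(1) Suc.prems by (simp add: is_play_def)
    show ?case
    proof (cases "alice_to_move (h ! i)")
      case True
      have last: "last (take (Suc i) h) = h ! i"
        using Suc.prems by (simp add: take_Suc_conv_app_nth)
      have "\<exists>r. legal G a b (h ! i) r \<and> safe G a b r"
        using safe_alice[OF IH True] leg unfolding game_over_def by blast
      then have "safe G a b (\<sigma> (take (Suc i) h))" using \<sigma>_safe[of "take (Suc i) h"] last by simp
      then show ?thesis using h(2) True Suc.prems by (simp add: follows_def)
    next
      case False
      then show ?thesis using safe_bob[OF IH] leg by blast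
    qed
  qed
  have "completed G (fst (last h))"
    if h: "is_play G a b pl h" "follows \<sigma> h" "game_over G a b (last h)" for h
  proof -
    have "h \<noteq> []" using h(1) by (simp add: is_play_def)
    then have "safe G a b (last h)"
      using all_safe[OF h(1,2), of "length h - 1"]
      by (simp add: last_conv_nth)
    then show ?thesis using h(3) by (rule safe_completed)
  qed
  then show "alice_wins G a b pl"
    using strat unfolding alice_wins_def winning_strategy_def by blast
qed

text \<open>Equality of \<^const>\<open>completed\<close> is demanded only for boards on which a game can end, namely when no
  turn is possible or the upper bound on the number of turns has dropped to 0.\<close>

definition game_bisimulation :: "'p game \<Rightarrow> 'q game \<Rightarrow> ('p \<Rightarrow> 'q \<Rightarrow> bool) \<Rightarrow> bool" where
  "game_bisimulation G H R \<longleftrightarrow> R (start G) (start H) \<and>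
     (\<forall>x y. R x y \<longrightarrow>
        remaining G x = remaining H y \<and>
        (\<forall>x'. turn G x x' \<longrightarrow> (\<exists>y'. turn H y y' \<and> R x' y')) \<and>
        (\<forall>y'. turn H y y' \<longrightarrow> (\<exists>x'. turn G x x' \<and> R x' y')) \<and>
        (remaining G x = 0 \<or> (\<nexists>x'. turn G x x') \<longrightarrow> completed G x = completed H y))"

lemma game_bisimulation_remaining:
  "game_bisimulation G H R \<Longrightarrow> R x y \<Longrightarrow> remaining G x = remaining H y"
  by (simp add: game_bisimulation_def)

lemma game_bisimulation_turn:
  "game_bisimulation G H R \<Longrightarrow> R x y \<Longrightarrow> turn G x x' \<Longrightarrow> \<exists>y'. turn H y y' \<and> R x' y'"
  by (simp add: game_bisimulation_def)

lemma game_bisimulation_conversep: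
  assumes "game_bisimulation G H R"
  shows "game_bisimulation H G (conversep R)"
proof -
  have "R (start G) (start H)" using assms by (simp add: game_bisimulation_def)
  moreover have "remaining H y = remaining G x \<and>
        (\<forall>y'. turn H y y' \<longrightarrow> (\<exists>x'. turn G x x' \<and> R x' y')) \<and>
        (\<forall>x'. turn G x x' \<longrightarrow> (\<exists>y'. turn H y y' \<and> R x' y')) \<and>
        (remaining H y = 0 \<or> (\<nexists>y'. turn H y y') \<longrightarrow> completed H y = completed G x)"
    if "R x y" for x y
  proof -
    have xy: "remaining G x = remaining H y"
        "\<forall>x'. turn G x x' \<longrightarrow> (\<exists>y'. turn H y y' \<and> R x' y')"
        "\<forall>y'. turn H y y' \<longrightarrow> (\<exists>x'. turn G x x' \<and> R x' y')"
        "remaining G x = 0 \<or> (\<nexists>x'. turn G x x') \<longrightarrow> completed G x = completed H y"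
      using assms that by (simp_all add: game_bisimulation_def)
    then have "(\<exists>y'. turn H y y') \<longleftrightarrow> (\<exists>x'. turn G x x')" by blast
    with xy show ?thesis by simp
  qed
  ultimately show ?thesis by (simp add: game_bisimulation_def)
qed

text \<open>A position whose player has no turns left (\<open>k = 0\<close>) is stuck although its board may admit turns.
  With positive quotas this happens only when nothing remains, and the last conjunct keeps this
  information for comparing the final boards.\<close>

definition lift_position :: "'p game \<Rightarrow> ('p \<Rightarrow> 'q \<Rightarrow> bool) \<Rightarrow> 'p position \<Rightarrow> 'q position \<Rightarrow> bool" where
  "lift_position G R = (\<lambda>(x, pl, k) (y, pl', k'). R x y \<and> pl' = pl \<and> k' = k \<and>
     (k = 0 \<longrightarrow> remaining G x = 0))"

lemma lift_position_conversep:
  assumes "game_bisimulation G H R"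
  shows "lift_position H (conversep R) = conversep (lift_position G R)"
proof (intro ext)
  fix q' q
  show "lift_position H (conversep R) q' q = conversep (lift_position G R) q' q"
    using game_bisimulation_remaining[OF assms]
    by (cases q; cases q') (auto simp: lift_position_def)
qed

lemma lift_position_new_move:
  assumes "game_bisimulation G H R" "a > 0" "b > 0" "R x y"
  shows "lift_position G R (new_move G a b pl x) (new_move H a b pl y)"
  using assms(2-4) game_bisimulation_remaining[OF assms(1,4)]
  by (cases pl) (auto simp: lift_position_def new_move_def min_def)

lemma lift_position_legal:
  assumes bis: "game_bisimulation G H R" and ab: "a > 0" "b > 0"
    and "lift_position G R q q'" "legal G a b q r"
  shows "\<exists>r'. legal H a b q' r' \<and> lift_position G R r r'"
  using assms(5,4)
proof (cases rule: legal.cases)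
  case (same_move x y k pl)
  obtain x' where q': "q' = (x', pl, k)" "R x x'"
    using assms(4) same_move by (cases q') (auto simp: lift_position_def)
  obtain y' where y': "turn H x' y'" "R y y'"
    using game_bisimulation_turn[OF bis q'(2)] same_move by blast
  have "legal H a b q' (y', pl, k - 1)"
    unfolding q' by (rule legal.same_move) (use y' same_move in auto)
  moreover have "lift_position G R r (y', pl, k - 1)"
    using same_move y' by (simp add: lift_position_def)
  ultimately show ?thesis by blast
next
  case (end_move x y pl)
  obtain x' where q': "q' = (x', pl, 1)" "R x x'"
    using assms(4) end_move by (cases q') (auto simp: lift_position_def)
  obtain y' where y': "turn H x' y'" "R y y'"
    using game_bisimulation_turn[OF bis q'(2)] end_move by blast
  have "legal H a b q' (new_move H a b (opponent pl) y')"
    unfolding q' by (rule legal.end_move) (use y' in auto)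
  then show ?thesis using lift_position_new_move[OF bis ab y'(2)] end_move by blast
qed

text \<open>The safe positions of one game, transported along the bisimulation, are closed under the rules
  defining safety in the other.\<close>

lemma lift_position_safe:
  assumes bis: "game_bisimulation G H R" and ab: "a > 0" "b > 0"
    and "lift_position G R q q'" "safe G a b q"
  shows "safe H a b q'"
proof (rule safe_coinduct[where X = "\<lambda>q'. \<exists>q. lift_position G R q q' \<and> safe G a b q"])
  show "\<exists>q. lift_position G R q q' \<and> safe G a b q" using assms(4,5) by blast
next
  fix q' assume "\<exists>q. lift_position G R q q' \<and> safe G a b q"
  then obtain q where safe: "lift_position G R q q'" "safe G a b q" by blast
  note forth = lift_position_legal[OF bis ab safe(1)]
  have bwd: "\<exists>r. legal G a b q r \<and> lift_position G R r r'" if "legal H a b q' r'" for r'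
    using lift_position_legal[OF game_bisimulation_conversep[OF bis] ab, of q' q r'] that safe(1)
    by (simp add: lift_position_conversep[OF bis])
  have over: "game_over H a b q' \<longleftrightarrow> game_over G a b q"
    using forth bwd unfolding game_over_def by blast
  have same_player: "alice_to_move q' \<longleftrightarrow> alice_to_move q"
    using safe(1) by (auto simp: alice_to_move_def lift_position_def)
  show "completed H (fst q')" if "game_over H a b q'"
  proof -
    obtain x pl k y where q: "q = (x, pl, k)" "q' = (y, pl, k)" "R x y"
        "k = 0 \<Longrightarrow> remaining G x = 0"
      using safe(1) by (cases q; cases q') (auto simp: lift_position_def)
    have "remaining G x = 0 \<or> (\<nexists>x'. turn G x x')"
    proof (cases "k = 0")
      case False
      have "\<exists>r. legal G a b q r" if "turn G x x'" for x'
      proof (cases "k = 1")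
        case True
        then show ?thesis using legal.end_move[OF that] q(1) by blast
      next
        case k: False
        then have "k > 1" using False by simp
        then show ?thesis using legal.same_move[OF that] q(1) by blast
      qed
      then show ?thesis using that over unfolding game_over_def by blast
    qed (use q in simp)
    moreover have "completed G x"
      using safe_completed[OF safe(2)] that over q by auto
    ultimately show ?thesis using bis q unfolding game_bisimulation_def by auto
  qed
  show "\<exists>r'. legal H a b q' r' \<and> (\<exists>q. lift_position G R q r' \<and> safe G a b q)"
    if H_turn: "alice_to_move q'" "\<not> game_over H a b q'"
  proof -
    obtain r where "legal G a b q r" "safe G a b r"
      using safe_alice[OF safe(2)] H_turn over same_player by blast
    then show ?thesis using forth by blast
  qed
  show "\<exists>q. lift_position G R q r' \<and> safe G a b q"
    if H_turn: "\<not> alice_to_move q'" "legal H a b q' r'" for r'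
  proof -
    obtain r where "legal G a b q r" "lift_position G R r r'" using bwd H_turn by blast
    moreover have "safe G a b r"
      using safe_bob[OF safe(2)] \<open>legal G a b q r\<close> H_turn same_player by blast
    ultimately show ?thesis by blast
  qed
qed

theorem alice_wins_bisimulation:
  assumes bis: "game_bisimulation G H R" and ab: "a > 0" "b > 0"
  shows "alice_wins G a b pl \<longleftrightarrow> alice_wins H a b pl"
proof -
  have "lift_position G R (new_move G a b pl (start G)) (new_move H a b pl (start H))"
    using lift_position_new_move[OF bis ab] bis by (simp add: game_bisimulation_def)
  then show ?thesis
    using lift_position_safe[OF bis ab]
      lift_position_safe[OF game_bisimulation_conversep[OF bis] ab]
    unfolding alice_wins_iff_safe lift_position_conversep[OF bis] conversep_iff by blast
qed

section \<open>Cell orbits of a feasible principal isotopism\<close>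

lemma cycle_length_dvd_iff:
  assumes "permutation p"
  shows "cycle_length p s dvd m \<longleftrightarrow> (p ^^ m) s = s"
proof -
  have "distinct (support p s)" using cycle_of_permutation[OF assms] by blast
  then have "card (set (support p s)) = length (support p s)" by (rule distinct_card)
  moreover have "orbit p s = set (support p s)"
    unfolding support_set[OF assms] orbit_altdef_permutation[OF assms] by blast
  ultimately have "cycle_length p s = least_power p s"
    unfolding cycle_length_def by simp
  then show ?thesis by (simp only: least_power_dvd[OF assms])
qed

lemma cycle_length_id: "cycle_length id s = 1"
proof -
  have "orbit id s = {s}" by (simp add: orbit_eq_singleton_iff)
  then show ?thesis by (simp add: cycle_length_def)
qed

lemma finite_cells: "finite (cells ns)"
proof (rule finite_subset)
  show "cells ns \<subseteq> {c. set c \<subseteq> {..Max (set ns)} \<and> length c = length ns}"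
  proof
    fix c assume c: "c \<in> cells ns"
    have "c ! j \<le> Max (set ns)" if "j < length ns" for j
    proof -
      have "ns ! j \<le> Max (set ns)" using that by (intro Max_ge) auto
      moreover have "c ! j \<le> ns ! j" using c that by (simp add: cells_def)
      ultimately show ?thesis by linarith
    qed
    then show "c \<in> {c. set c \<subseteq> {..Max (set ns)} \<and> length c = length ns}"
      using c by (auto simp: cells_def in_set_conv_nth)
  qed
qed (rule finite_lists_length_eq, simp)

locale feasible_principal_isotopism =
  fixes ns :: "nat list" and n :: nat and \<Theta> :: isotopism
  assumes isotopism: "\<Theta> \<in> isotopisms ns n"
    and principal: "principal \<Theta>"
    and feasible: "feasible ns n \<Theta>"
    and pos: "n > 0"
begin

lemma length_\<Theta> [simp]: "length (fst \<Theta>) = length ns"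
  using isotopism by (auto simp: isotopisms_def)

lemma \<Theta>_permutes: "j < length ns \<Longrightarrow> (fst \<Theta> ! j) permutes {1..ns ! j}"
  using isotopism by (auto simp: isotopisms_def)

lemma \<Theta>_permutation: "j < length ns \<Longrightarrow> permutation (fst \<Theta> ! j)"
  using \<Theta>_permutes permutation_permutes by blast

lemma snd_\<Theta>: "snd \<Theta> = id"
  using principal by (simp add: principal_def)

lemma extension_eqs:
  "snd (natural_extension n \<Theta>) = id"
  "shift (natural_extension n \<Theta>) = shift \<Theta>"
  "cell_cycle_lengths (natural_extension n \<Theta>) = cell_cycle_lengths \<Theta>"
  by (simp_all add: natural_extension_def snd_\<Theta> shift_def cell_cycle_lengths_def fun_eq_iff)

lemma length_cell: "c \<in> cells ns \<Longrightarrow> length c = length ns"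
  by (simp add: cells_def)

lemma length_shift [simp]: "length c = length ns \<Longrightarrow> length (shift \<Theta> m c) = length ns"
  by (simp add: shift_def)

lemma nth_shift [simp]:
  "length c = length ns \<Longrightarrow> j < length ns \<Longrightarrow> shift \<Theta> m c ! j = ((fst \<Theta> ! j) ^^ m) (c ! j)"
  by (simp add: shift_def)

lemma shift_shift: "length c = length ns \<Longrightarrow> shift \<Theta> m (shift \<Theta> k c) = shift \<Theta> (m + k) c"
  by (rule nth_equalityI) (auto simp: funpow_add)

lemma shift_0: "length c = length ns \<Longrightarrow> shift \<Theta> 0 c = c"
  by (rule nth_equalityI) auto

lemma shift_in_cells: "c \<in> cells ns \<Longrightarrow> shift \<Theta> m c \<in> cells ns"
  using permutes_in_image[OF permutes_funpow[OF \<Theta>_permutes]] by (auto simp: cells_def)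

lemma length_cell_cycle_lengths:
  "length c = length ns \<Longrightarrow> length (cell_cycle_lengths \<Theta> c) = length ns"
  by (simp add: cell_cycle_lengths_def)

lemma nth_cell_cycle_lengths:
  "length c = length ns \<Longrightarrow> j < length ns \<Longrightarrow>
     cell_cycle_lengths \<Theta> c ! j = cycle_length (fst \<Theta> ! j) (c ! j)"
  by (simp add: cell_cycle_lengths_def)

text \<open>The final 1 is the cycle length of any symbol under the identity; feasibility speaks about it
  because there is at least one symbol.\<close>

lemma lcm_compatible_cell:
  assumes c: "c \<in> cells ns"
  shows "lcm_compatible (cell_cycle_lengths \<Theta> c @ [1])"
proof -
  note len = length_cell[OF c]
  have orb: "orbit (fst \<Theta> ! j) (c ! j) \<subseteq> {1..ns ! j}" if "j < length ns" for j
    using permutes_orbit_subset[OF \<Theta>_permutes[OF that]] c that by (auto simp: cells_def)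
  have bounds: "cell_cycle_lengths \<Theta> c ! j \<in> {1..ns ! j}" if "j < length ns" for j
  proof -
    have "card (orbit (fst \<Theta> ! j) (c ! j)) \<le> ns ! j"
      using card_mono[OF _ orb[OF that]] by simp
    moreover have "card (orbit (fst \<Theta> ! j) (c ! j)) \<noteq> 0"
      using finite_subset[OF orb[OF that]] orbit_nonempty[of "fst \<Theta> ! j" "c ! j"] by auto
    ultimately show ?thesis
      using that len by (simp add: nth_cell_cycle_lengths cycle_length_def)
  qed
  have num_pos: "num_cycles m p (cycle_length p s) > 0" if "s \<in> {1..m}" for m p s
  proof -
    have "finite {C. (\<exists>s\<in>{1..m}. C = orbit p s) \<and> card C = cycle_length p s}"
      by (rule finite_subset[of _ "orbit p ` {1..m}"]) auto
    moreover have "orbit p s \<in> {C. (\<exists>s\<in>{1..m}. C = orbit p s) \<and> card C = cycle_length p s}"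
      using that by (auto simp: cycle_length_def)
    ultimately show ?thesis unfolding num_cycles_def card_gt_0_iff by blast
  qed
  have "cell_cycle_lengths \<Theta> c \<in> cells ns"
    using bounds len by (simp add: cells_def length_cell_cycle_lengths)
  moreover have "num_cycles n (snd \<Theta>) 1 > 0"
    using num_pos[of 1 n id] pos by (simp add: snd_\<Theta> cycle_length_id)
  moreover have "num_cycles (ns ! j) (fst \<Theta> ! j) (cell_cycle_lengths \<Theta> c ! j) > 0"
    if "j < length ns" for j
    using num_pos c that len by (simp add: nth_cell_cycle_lengths cells_def)
  then have "(\<Prod>j<length ns. num_cycles (ns ! j) (fst \<Theta> ! j) (cell_cycle_lengths \<Theta> c ! j)) > 0"
    by (intro prod_pos) auto
  moreover have "(1 :: nat) \<in> {1..n}" using pos by simp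
  ultimately show ?thesis
    using feasible unfolding feasible_def by (meson mult_pos_pos)
qed

text \<open>If the shift by \<open>m\<close> fixes every coordinate except possibly the \<open>j\<close>-th, then \<open>m\<close> is a common multiple
  of all the other cycle lengths; lcm-compatibility makes it a multiple of the \<open>j\<close>-th as well.\<close>

lemma shift_not_collinear:
  assumes c: "c \<in> cells ns"
  shows "\<not> adj (hamming_graph ns) c (shift \<Theta> m c)"
proof
  assume "adj (hamming_graph ns) c (shift \<Theta> m c)"
  then have "card {j. j < length ns \<and> c ! j \<noteq> shift \<Theta> m c ! j} = 1"
    by (simp add: hamming_graph_def)
  then obtain j where diff: "{j. j < length ns \<and> c ! j \<noteq> shift \<Theta> m c ! j} = {j}"
    by (rule card_1_singletonE)
  note len = length_cell[OF c]
  let ?ls = "cell_cycle_lengths \<Theta> c @ [1]"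
  have j: "j < length ns" "shift \<Theta> m c ! j \<noteq> c ! j"
  proof -
    have "j \<in> {j. j < length ns \<and> c ! j \<noteq> shift \<Theta> m c ! j}" unfolding diff by simp
    then show "j < length ns" "shift \<Theta> m c ! j \<noteq> c ! j" by simp_all
  qed
  have j_less: "j < length ?ls" using j len by (simp add: length_cell_cycle_lengths)
  have dvd_iff: "?ls ! i dvd m \<longleftrightarrow> shift \<Theta> m c ! i = c ! i" if "i < length ns" for i
    using that len cycle_length_dvd_iff[OF \<Theta>_permutation[OF that]]
    by (simp add: nth_append length_cell_cycle_lengths nth_cell_cycle_lengths)
  have "?ls ! i dvd m" if "i \<in> {..<length ?ls} - {j}" for i
  proof (cases "i < length ns")
    case True
    then have "shift \<Theta> m c ! i = c ! i" using diff that by force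
    then show ?thesis using dvd_iff[OF True] by simp
  next
    case False
    then have "i = length ns" using that len by (simp add: length_cell_cycle_lengths)
    then show ?thesis using len by (simp add: nth_append length_cell_cycle_lengths)
  qed
  then have "(LCM i\<in>{..<length ?ls} - {j}. ?ls ! i) dvd m" by (intro Lcm_least) blast
  moreover have "(LCM i\<in>{..<length ?ls} - {j}. ?ls ! i) = (LCM i\<in>{..<length ?ls}. ?ls ! i)"
    using lcm_compatible_cell[OF c, unfolded lcm_compatible_def, THEN conjunct2, rule_format, OF j_less] .
  moreover have "?ls ! j dvd (LCM i\<in>{..<length ?ls}. ?ls ! i)"
    using j_less by (intro dvd_Lcm imageI) (rule lessThan_iff[THEN iffD2])
  ultimately have "?ls ! j dvd m" by (simp only: dvd_trans)
  then show False using dvd_iff[OF j(1)] j(2) by blast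
qed

text \<open>The bound on \<open>m\<close> in Rule 3. Shifts repeat with this period, so together with the cell itself the
  rule covers the entire orbit.\<close>

abbreviation "period c \<equiv> Lcm (set (cell_cycle_lengths \<Theta> c))"

lemma shift_mod_period:
  assumes c: "c \<in> cells ns"
  shows "shift \<Theta> (m mod period c) c = shift \<Theta> m c"
proof -
  note len = length_cell[OF c]
  have "((fst \<Theta> ! j) ^^ (m mod period c)) (c ! j) = ((fst \<Theta> ! j) ^^ m) (c ! j)"
    if j: "j < length ns" for j
  proof -
    have "cycle_length (fst \<Theta> ! j) (c ! j) dvd period c"
      using j len nth_mem[of j "cell_cycle_lengths \<Theta> c"]
      by (intro dvd_Lcm) (simp add: nth_cell_cycle_lengths length_cell_cycle_lengths)
    then have "((fst \<Theta> ! j) ^^ period c) (c ! j) = c ! j"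
      by (simp only: cycle_length_dvd_iff[OF \<Theta>_permutation[OF j]])
    then show ?thesis by (rule funpow_mod_eq)
  qed
  then show ?thesis using len by (intro nth_equalityI) auto
qed

lemma period_pos:
  assumes c: "c \<in> cells ns"
  shows "period c > 0"
proof -
  have "0 \<notin> set (cell_cycle_lengths \<Theta> c)"
    using lcm_compatible_cell[OF c] by (auto simp: lcm_compatible_def)
  then have "period c \<noteq> 0" using Lcm_0_iff[OF finite_set] by metis
  then show ?thesis by (rule neq0_conv[THEN iffD1])
qed

lemma self_in_cell_orbit: "c \<in> cells ns \<Longrightarrow> c \<in> cell_orbit \<Theta> c"
  using shift_0[OF length_cell] unfolding cell_orbit_def by (metis rangeI)

lemma cell_orbit_subset_cells: "c \<in> cells ns \<Longrightarrow> cell_orbit \<Theta> c \<subseteq> cells ns"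
  using shift_in_cells by (auto simp: cell_orbit_def)

lemma in_cell_orbitE:
  assumes "c' \<in> cell_orbit \<Theta> c" "c \<in> cells ns"
  obtains m where "m < period c" "c' = shift \<Theta> m c"
proof -
  obtain m where "c' = shift \<Theta> m c" using assms(1) by (auto simp: cell_orbit_def)
  then show thesis
    using that[of "m mod period c"] assms(2) period_pos shift_mod_period by simp
qed

lemma cell_orbit_eq:
  assumes "c' \<in> cell_orbit \<Theta> c" and c: "c \<in> cells ns"
  shows "cell_orbit \<Theta> c' = cell_orbit \<Theta> c"
proof -
  note len = length_cell[OF c]
  obtain m where m: "m < period c" "c' = shift \<Theta> m c" using in_cell_orbitE[OF assms] .
  \<comment> \<open>Shifting by the rest of the period leads back, so each orbit contains the other.\<close>
  have "shift \<Theta> (period c - m) c' = c"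
    using m len shift_mod_period[OF c, of "period c"] by (simp add: shift_shift shift_0)
  then have "shift \<Theta> k c = shift \<Theta> (k + (period c - m)) c'" for k
    using m len by (metis length_shift shift_shift)
  moreover have "shift \<Theta> k c' = shift \<Theta> (k + m) c" for k
    using m len by (simp add: shift_shift)
  ultimately show ?thesis unfolding cell_orbit_def by blast
qed

lemma hamming_sym: "adj (hamming_graph ns) c c' \<Longrightarrow> adj (hamming_graph ns) c' c"
  by (auto simp: hamming_graph_def eq_commute)

lemma hamming_shift:
  assumes "adj (hamming_graph ns) c c'"
  shows "adj (hamming_graph ns) (shift \<Theta> m c) (shift \<Theta> m c')"
proof -
  have c: "c \<in> cells ns" "c' \<in> cells ns" using assms by (auto simp: hamming_graph_def)
  have "((fst \<Theta> ! j) ^^ m) x = ((fst \<Theta> ! j) ^^ m) y \<longleftrightarrow> x = y" if "j < length ns" for j x y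
    using permutes_inj[OF permutes_funpow[OF \<Theta>_permutes[OF that]]] by (auto dest: injD)
  then have "{j. j < length ns \<and> shift \<Theta> m c ! j \<noteq> shift \<Theta> m c' ! j}
      = {j. j < length ns \<and> c ! j \<noteq> c' ! j}"
    using c by (auto simp: length_cell)
  then show ?thesis using assms c shift_in_cells by (simp add: hamming_graph_def)
qed

lemma adjacent_orbits:
  assumes "adj (hamming_graph ns) c c'"
  shows "adj (orbit_contraction_graph ns \<Theta>) (cell_orbit \<Theta> c) (cell_orbit \<Theta> c')"
proof -
  have c: "c \<in> cells ns" "c' \<in> cells ns" using assms by (auto simp: hamming_graph_def)
  have "cell_orbit \<Theta> c \<noteq> cell_orbit \<Theta> c'"
  proof
    assume "cell_orbit \<Theta> c = cell_orbit \<Theta> c'"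
    then have "c' \<in> cell_orbit \<Theta> c" using c self_in_cell_orbit by blast
    then show False using assms shift_not_collinear[OF c(1)] by (auto simp: cell_orbit_def)
  qed
  then show ?thesis
    using assms c self_in_cell_orbit by (auto simp: orbit_contraction_graph_def)
qed

lemma contraction_adj_sym:
  assumes "adj (orbit_contraction_graph ns \<Theta>) A B"
  shows "adj (orbit_contraction_graph ns \<Theta>) B A"
proof -
  obtain c c' where "c \<in> A" "c' \<in> B" "adj (hamming_graph ns) c c'"
    using assms by (auto simp: orbit_contraction_graph_def)
  then have "\<exists>c'\<in>B. \<exists>c\<in>A. adj (hamming_graph ns) c' c" using hamming_sym by blast
  then show ?thesis using assms by (auto simp: orbit_contraction_graph_def)
qed

lemma finite_cell_orbit: "c \<in> cells ns \<Longrightarrow> finite (cell_orbit \<Theta> c)"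
  by (rule finite_subset[OF cell_orbit_subset_cells finite_cells])

section \<open>Contracting a partial array to a coloured orbit graph\<close>

text \<open>The array \<open>P\<close> contracts to the board \<open>(f, \<omega>)\<close>. Only the values at actual orbits are constrained.
  The colouring \<open>f\<close> is required to be proper: for \<open>P\<close> this is stronger than the Latin condition, as it
  accounts for all cells of an orbit once one of them is coloured, and it is what Rule 3 protects.\<close>

definition contracts :: "nat \<Rightarrow> array \<Rightarrow> (cell set \<rightharpoonup> nat) \<times> (cell set \<Rightarrow> nat) \<Rightarrow> bool" where
  "contracts n' P = (\<lambda>(f, \<omega>). dom P \<subseteq> cells ns \<and>
     (\<forall>c\<in>cells ns. \<forall>s. P c = Some s \<longrightarrow> f (cell_orbit \<Theta> c) = Some s) \<and>
     (\<forall>c\<in>cells ns. f (cell_orbit \<Theta> c) \<noteq> None \<longrightarrow> (\<exists>c'\<in>cell_orbit \<Theta> c. P c' \<noteq> None)) \<and>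
     (\<forall>c\<in>cells ns. \<forall>s. f (cell_orbit \<Theta> c) = Some s \<longrightarrow> s \<in> {1..n'}) \<and>
     (\<forall>A B s. adj (orbit_contraction_graph ns \<Theta>) A B \<longrightarrow> f A = Some s \<longrightarrow> f B \<noteq> Some s) \<and>
     (\<forall>c\<in>cells ns. \<omega> (cell_orbit \<Theta> c) = card {c' \<in> cell_orbit \<Theta> c. P c' = None}))"

context
  fixes n' P f \<omega>
  assumes contracts: "contracts n' P (f, \<omega>)"
begin

lemma contracts_dom: "P c = Some s \<Longrightarrow> c \<in> cells ns"
  using contracts by (auto simp: contracts_def)

lemma contracts_colour: "P c = Some s \<Longrightarrow> f (cell_orbit \<Theta> c) = Some s"
  using contracts contracts_dom by (auto simp: contracts_def)

lemma contracts_coloured_cell: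
  assumes c: "c \<in> cells ns" and "f (cell_orbit \<Theta> c) = Some s"
  shows "\<exists>c'\<in>cell_orbit \<Theta> c. P c' = Some s"
proof -
  obtain c' t where c': "c' \<in> cell_orbit \<Theta> c" "P c' = Some t"
    using contracts assms by (fastforce simp: contracts_def)
  then have "t = s" using contracts_colour[OF c'(2)] cell_orbit_eq[OF c'(1) c] assms(2) by simp
  then show ?thesis using c' by blast
qed

lemma contracts_symbol:
  "c \<in> cells ns \<Longrightarrow> f (cell_orbit \<Theta> c) = Some s \<Longrightarrow> s \<in> {1..n'}"
  using contracts by (auto simp: contracts_def)

lemma contracts_proper:
  "adj (orbit_contraction_graph ns \<Theta>) A B \<Longrightarrow> f A = Some s \<Longrightarrow> f B \<noteq> Some s"
  using contracts by (simp add: contracts_def)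

lemma contracts_weight:
  "c \<in> cells ns \<Longrightarrow> \<omega> (cell_orbit \<Theta> c) = card {c' \<in> cell_orbit \<Theta> c. P c' = None}"
  using contracts by (simp add: contracts_def)

lemma contracts_weight_pos_iff:
  assumes "c \<in> cells ns"
  shows "\<omega> (cell_orbit \<Theta> c) > 0 \<longleftrightarrow> (\<exists>c'\<in>cell_orbit \<Theta> c. P c' = None)"
  using finite_cell_orbit[OF assms] by (auto simp: contracts_weight[OF assms] card_gt_0_iff)

text \<open>The next three lemmas show that the rules of the stabilized game are consequences of the
  contraction. To realize a turn of the modified game it therefore suffices that the new array
  contracts to the new board.\<close>

lemma contracts_latin_array: "latin_array ns P"
  unfolding latin_array_def
proof (intro ballI impI notI)
  fix c c' assume "c \<in> dom P" "adj (hamming_graph ns) c c'" "P c = P c'"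
  then show False
    using contracts_proper[OF adjacent_orbits] contracts_colour by (metis domD)
qed

lemma contracts_compatible: "compatible (natural_extension n \<Theta>) P"
proof -
  have "P (shift \<Theta> m c) = None \<or> P (shift \<Theta> m c) = Some s" if P: "P c = Some s" for c s m
  proof (cases "P (shift \<Theta> m c)")
    case (Some t)
    have "cell_orbit \<Theta> (shift \<Theta> m c) = cell_orbit \<Theta> c"
      using cell_orbit_eq[OF _ contracts_dom[OF P]] by (simp add: cell_orbit_def)
    then show ?thesis using contracts_colour[OF P] contracts_colour[OF Some] Some by simp
  qed simp
  moreover have "lcm_compatible (cell_cycle_lengths \<Theta> c @ [1])" if "P c = Some s" for c s
    using lcm_compatible_cell[OF contracts_dom[OF that]] .
  ultimately show ?thesis
    unfolding compatible_def extension_eqs cycle_length_id id_funpow id_apply by blast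
qed

lemma contracts_no_future_conflict:
  assumes P: "P c = Some s"
  shows "no_future_conflict ns (natural_extension n \<Theta>) P c s"
proof -
  have "P c' \<noteq> Some s" if "adj (hamming_graph ns) c' (shift \<Theta> m c)" for c' m
  proof
    assume P': "P c' = Some s"
    have "cell_orbit \<Theta> (shift \<Theta> m c) = cell_orbit \<Theta> c"
      using cell_orbit_eq[OF _ contracts_dom[OF P]] by (simp add: cell_orbit_def)
    then show False
      using contracts_proper[OF adjacent_orbits[OF that] contracts_colour[OF P']]
        contracts_colour[OF P] by simp
  qed
  then show ?thesis unfolding no_future_conflict_def extension_eqs by simp
qed

text \<open>Both kinds of turns at once: when the orbit already has colour \<open>s\<close>, the update of \<open>f\<close> changes
  nothing and only the weight drops.\<close>

lemma contracts_fun_upd: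
  assumes c: "c \<in> cells ns" "P c = None" and s: "s \<in> {1..n'}"
    and old: "f (cell_orbit \<Theta> c) = None \<or> f (cell_orbit \<Theta> c) = Some s"
    and nbs: "\<And>B. adj (orbit_contraction_graph ns \<Theta>) (cell_orbit \<Theta> c) B \<Longrightarrow> f B \<noteq> Some s"
  shows "contracts n' (P(c \<mapsto> s))
    (f(cell_orbit \<Theta> c \<mapsto> s), \<omega>(cell_orbit \<Theta> c := \<omega> (cell_orbit \<Theta> c) - 1))"
proof -
  let ?v = "cell_orbit \<Theta> c" and ?P = "P(c \<mapsto> s)"
  let ?f = "f(?v \<mapsto> s)" and ?\<omega> = "\<omega>(?v := \<omega> ?v - 1)"
  have "dom ?P \<subseteq> cells ns" using c contracts_dom by auto
  moreover have "?f (cell_orbit \<Theta> d) = Some t" if "?P d = Some t" for d t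
    using that old contracts_colour[of d t] by (auto split: if_splits)
  moreover have "\<exists>d'\<in>cell_orbit \<Theta> d. ?P d' \<noteq> None"
    if d: "d \<in> cells ns" and coloured: "?f (cell_orbit \<Theta> d) \<noteq> None" for d
  proof (cases "cell_orbit \<Theta> d = ?v")
    case True
    then show ?thesis using self_in_cell_orbit[OF c(1)] by auto
  next
    case False
    then obtain t where "f (cell_orbit \<Theta> d) = Some t" using coloured by auto
    then obtain d' where d': "d' \<in> cell_orbit \<Theta> d" "P d' = Some t"
      using contracts_coloured_cell[OF d] by blast
    then show ?thesis by (intro bexI[of _ d']) auto
  qed
  moreover have "t \<in> {1..n'}" if "d \<in> cells ns" "?f (cell_orbit \<Theta> d) = Some t" for d t
    using that s contracts_symbol[of d t] by (auto split: if_splits)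
  moreover have "?f B \<noteq> Some t"
    if AB: "adj (orbit_contraction_graph ns \<Theta>) A B" and A: "?f A = Some t" for A B t
  proof -
    have "A \<noteq> B" using AB by (simp add: orbit_contraction_graph_def)
    then show ?thesis
      using AB A nbs[of A] nbs[of B] contracts_proper[OF AB, of t] contraction_adj_sym[OF AB]
      by (auto split: if_splits)
  qed
  moreover have "?\<omega> (cell_orbit \<Theta> d) = card {c' \<in> cell_orbit \<Theta> d. ?P c' = None}"
    if d: "d \<in> cells ns" for d
  proof (cases "cell_orbit \<Theta> d = ?v")
    case True
    have "{c' \<in> ?v. ?P c' = None} = {c' \<in> ?v. P c' = None} - {c}" by auto
    then show ?thesis
      using True c self_in_cell_orbit[OF c(1)] finite_cell_orbit[OF c(1)] contracts_weight[OF c(1)]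
      by (simp add: card_Diff_singleton)
  next
    case False
    then have "c \<notin> cell_orbit \<Theta> d" using cell_orbit_eq[OF _ d] by metis
    then have "{c' \<in> cell_orbit \<Theta> d. ?P c' = None} = {c' \<in> cell_orbit \<Theta> d. P c' = None}" by auto
    then show ?thesis using False contracts_weight[OF d] by simp
  qed
  ultimately show ?thesis unfolding contracts_def by blast
qed

lemma contracts_remaining:
  "card {c \<in> cells ns. P c = None} = (\<Sum>v\<in>cell_orbit \<Theta> ` cells ns. \<omega> v)"
proof -
  let ?V = "cell_orbit \<Theta> ` cells ns"
  have "v = w" if "v \<in> ?V" "w \<in> ?V" "x \<in> v" "x \<in> w" for v w x
    using that cell_orbit_eq by (metis imageE)
  then have "card (\<Union>v\<in>?V. {c \<in> v. P c = None}) = (\<Sum>v\<in>?V. card {c \<in> v. P c = None})"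
    using finite_cells finite_cell_orbit by (intro card_UN_disjoint) auto
  moreover have "(\<Union>v\<in>?V. {c \<in> v. P c = None}) = {c \<in> cells ns. P c = None}"
    using self_in_cell_orbit cell_orbit_subset_cells by auto
  moreover have "(\<Sum>v\<in>?V. card {c \<in> v. P c = None}) = (\<Sum>v\<in>?V. \<omega> v)"
    using contracts_weight by (intro sum.cong) auto
  ultimately show ?thesis by simp
qed

text \<open>In an uncoloured orbit, a coloured cell \<open>d\<close> of an adjacent orbit need not itself be collinear with
  the new cell, but some shift of it is; shifting the collinear pair until its second entry becomes
  \<open>d\<close> gives a cell of the new orbit that is collinear with \<open>d\<close>, where the Latin condition (shift 0)
  or Rule 3 applies. In a coloured orbit, compatibility leaves only the symbol already used there.\<close>

lemma stabilized_turn_contracts: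
  assumes "turn (stabilized_game ns n \<Theta> n') P Q"
  shows "\<exists>y. modified_turn (orbit_contraction_graph ns \<Theta>) n' (f, \<omega>) y \<and> contracts n' Q y"
proof -
  obtain c s where c: "c \<in> cells ns" "P c = None" and s: "s \<in> {1..n'}" and Q: "Q = P(c \<mapsto> s)"
    and latin: "latin_array ns Q" and compat: "compatible (natural_extension n \<Theta>) Q"
    and future: "no_future_conflict ns (natural_extension n \<Theta>) Q c s"
    using assms by (auto simp: stabilized_game_def Let_def)
  let ?H = "orbit_contraction_graph ns \<Theta>" and ?v = "cell_orbit \<Theta> c"
  have v: "?v \<in> verts ?H" using c by (simp add: orbit_contraction_graph_def)
  show ?thesis
  proof (cases "f ?v")
    case None
    have nbs: "f u \<noteq> Some s" if adj: "adj ?H ?v u" for u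
    proof
      assume u: "f u = Some s"
      obtain x y where xy: "x \<in> ?v" "y \<in> u" "adj (hamming_graph ns) x y"
        using adj by (auto simp: orbit_contraction_graph_def)
      have y: "y \<in> cells ns" using xy by (simp add: hamming_graph_def)
      have u_eq: "u = cell_orbit \<Theta> y"
      proof -
        obtain z where "z \<in> cells ns" "u = cell_orbit \<Theta> z"
          using adj by (auto simp: orbit_contraction_graph_def)
        then show ?thesis using cell_orbit_eq xy(2) by simp
      qed
      obtain d where d: "d \<in> cell_orbit \<Theta> y" "P d = Some s"
        using contracts_coloured_cell[OF y] u u_eq by blast
      obtain k where k: "d = shift \<Theta> k y" using in_cell_orbitE[OF d(1) y] .
      have "shift \<Theta> k x \<in> ?v"
        unfolding cell_orbit_eq[OF xy(1) c(1), symmetric] by (simp add: cell_orbit_def)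
      then obtain m where m: "m < period c" "shift \<Theta> k x = shift \<Theta> m c"
        by (rule in_cell_orbitE[OF _ c(1)])
      have adj_d: "adj (hamming_graph ns) d (shift \<Theta> m c)"
        using hamming_sym[OF hamming_shift[OF xy(3), of k]] k m by simp
      have Qd: "Q d = Some s" using d c Q by auto
      show False
      proof (cases "m = 0")
        case True
        then have "adj (hamming_graph ns) d c"
          using adj_d c shift_0 length_cell by simp
        moreover have "d \<in> dom Q" "c \<in> dom Q" "Q d = Q c" using Qd Q by auto
        ultimately show False using latin unfolding latin_array_def by blast
      next
        case False
        then show False
          using future m(1) adj_d Qd domI[of Q d, OF Qd]
          unfolding no_future_conflict_def extension_eqs id_funpow id_apply by blast
      qed
    qed
    have "modified_turn ?H n' (f, \<omega>) (f(?v \<mapsto> s), \<omega>(?v := \<omega> ?v - 1))"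
      using v None s nbs by (intro modified_turn.colour_vertex)
    moreover have "contracts n' Q (f(?v \<mapsto> s), \<omega>(?v := \<omega> ?v - 1))"
      unfolding Q by (rule contracts_fun_upd[OF c s]) (simp_all add: None nbs)
    ultimately show ?thesis by blast
  next
    case (Some t)
    obtain d where d: "d \<in> ?v" "P d = Some t" using contracts_coloured_cell[OF c(1) Some] by blast
    have dc: "d \<in> cells ns" using contracts_dom d by blast
    have "c \<in> cell_orbit \<Theta> d"
      using cell_orbit_eq[OF d(1) c(1)] self_in_cell_orbit[OF c(1)] by simp
    then obtain m where m: "c = shift \<Theta> m d" by (rule in_cell_orbitE[OF _ dc])
    have "m > 0"
    proof (rule gr0I)
      assume "m = 0"
      then have "c = d" using m shift_0[OF length_cell[OF dc]] by simp
      then show False using c d by simp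
    qed
    moreover have "Q d = Some t" using d c Q by auto
    ultimately have "Q (shift \<Theta> m d) = None \<or> Q (shift \<Theta> m d) = Some ((id ^^ m) t)"
      using compat unfolding compatible_def extension_eqs by blast
    then have "s = t" unfolding m[symmetric] Q by simp
    then have f: "f(?v \<mapsto> s) = f" using Some by auto
    have "\<omega> ?v > 0" using contracts_weight_pos_iff[OF c(1)] c self_in_cell_orbit by blast
    then have "modified_turn ?H n' (f, \<omega>) (f, \<omega>(?v := \<omega> ?v - 1))"
      using v Some by (intro modified_turn.reduce_weight) auto
    moreover have "contracts n' Q (f(?v \<mapsto> s), \<omega>(?v := \<omega> ?v - 1))"
      unfolding Q
      by (rule contracts_fun_upd[OF c s]) (simp_all add: Some \<open>s = t\<close> contracts_proper)
    ultimately show ?thesis unfolding f by blast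
  qed
qed

end

text \<open>When a vertex is coloured, any cell of the orbit will do, as all of them are empty; when a weight is
  lowered, its positivity supplies an empty cell, which receives the symbol of its orbit.\<close>

lemma modified_turn_contracts:
  assumes con: "contracts n' P (f, \<omega>)"
    and "modified_turn (orbit_contraction_graph ns \<Theta>) n' (f, \<omega>) y"
  shows "\<exists>Q. turn (stabilized_game ns n \<Theta> n') P Q \<and> contracts n' Q y"
proof -
  let ?H = "orbit_contraction_graph ns \<Theta>"
  have turn: "turn (stabilized_game ns n \<Theta> n') P (P(c \<mapsto> s))"
    if cell: "c \<in> cells ns" "P c = None" "s \<in> {1..n'}" and after: "contracts n' (P(c \<mapsto> s)) y" for c s
  proof -
    obtain g \<omega>' where y: "contracts n' (P(c \<mapsto> s)) (g, \<omega>')" using after by (cases y) auto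
    show ?thesis
      using cell contracts_latin_array[OF y] contracts_compatible[OF y]
        contracts_no_future_conflict[OF y, of c s]
      unfolding stabilized_game_def Let_def
      by (simp only: game.simps) (intro bexI[of _ c] bexI[of _ s] conjI refl; simp)
  qed
  from assms(2) show ?thesis
  proof (cases rule: modified_turn.cases)
    case (colour_vertex v s)
    then obtain c where c: "c \<in> cells ns" "v = cell_orbit \<Theta> c"
      by (auto simp: orbit_contraction_graph_def)
    have "P c = None" using contracts_colour[OF con, of c] colour_vertex(3) c by (cases "P c") auto
    moreover have "f B \<noteq> Some s" if "adj ?H v B" for B
      using colour_vertex(5) that by (auto simp: orbit_contraction_graph_def)
    ultimately have "contracts n' (P(c \<mapsto> s)) y"
      using contracts_fun_upd[OF con c(1), of s] colour_vertex c by auto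
    then show ?thesis using turn[OF c(1) \<open>P c = None\<close>] colour_vertex by blast
  next
    case (reduce_weight v)
    then obtain c where c: "c \<in> cells ns" "v = cell_orbit \<Theta> c"
      by (auto simp: orbit_contraction_graph_def)
    obtain s where s: "f v = Some s" using reduce_weight by auto
    obtain c' where c': "c' \<in> v" "P c' = None"
      using contracts_weight_pos_iff[OF con c(1)] reduce_weight c by auto
    have orb: "cell_orbit \<Theta> c' = v" "c' \<in> cells ns"
      using c' c cell_orbit_eq[of c' c] cell_orbit_subset_cells[OF c(1)] by auto
    have sym: "s \<in> {1..n'}" using contracts_symbol[OF con c(1)] s c by simp
    have "contracts n' (P(c' \<mapsto> s)) (f(v \<mapsto> s), \<omega>(v := \<omega> v - 1))"
      using contracts_fun_upd[OF con orb(2) c'(2) sym] orb s contracts_proper[OF con] by auto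
    moreover have "f(v \<mapsto> s) = f" using s by auto
    ultimately have "contracts n' (P(c' \<mapsto> s)) y" using reduce_weight by simp
    then show ?thesis using turn[OF orb(2) c'(2) sym] by blast
  qed
qed

lemma contracts_game_bisimulation:
  "game_bisimulation (stabilized_game ns n \<Theta> n')
     (modified_game (orbit_contraction_graph ns \<Theta>) n') (contracts n')"
proof -
  let ?G = "stabilized_game ns n \<Theta> n'" and ?H = "orbit_contraction_graph ns \<Theta>"
  have G: "start ?G = Map.empty" "\<And>P. remaining ?G P = card {c \<in> cells ns. P c = None}"
      "\<And>P. completed ?G P \<longleftrightarrow> (\<forall>c\<in>cells ns. P c \<noteq> None)"
    by (simp_all add: stabilized_game_def Let_def)
  have H: "verts ?H = cell_orbit \<Theta> ` cells ns" "weight ?H = card"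
    by (simp_all add: orbit_contraction_graph_def)
  have initial: "contracts n' Map.empty (Map.empty, card)" by (simp add: contracts_def)
  have completed_iff: "completed ?G P \<longleftrightarrow> (\<forall>v\<in>verts ?H. f v \<noteq> None)"
    if con: "contracts n' P (f, \<omega>)" and over: "remaining ?G P = 0 \<or> (\<nexists>Q. turn ?G P Q)" for P f \<omega>
  proof
    assume "completed ?G P"
    then show "\<forall>v\<in>verts ?H. f v \<noteq> None"
      using contracts_colour[OF con] unfolding G H by (metis imageE not_None_eq)
  next
    assume coloured: "\<forall>v\<in>verts ?H. f v \<noteq> None"
    show "completed ?G P"
      unfolding G
    proof (intro ballI notI)
      fix c assume c: "c \<in> cells ns" "P c = None"
      have "\<omega> (cell_orbit \<Theta> c) > 0"
        using contracts_weight_pos_iff[OF con c(1)] c self_in_cell_orbit by blast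
      then have "\<exists>y. modified_turn ?H n' (f, \<omega>) y"
        using modified_turn.reduce_weight[of "cell_orbit \<Theta> c" ?H f \<omega> n'] coloured c H by blast
      then have "\<exists>Q. turn ?G P Q" using modified_turn_contracts[OF con] by blast
      moreover have "remaining ?G P \<noteq> 0" unfolding G using c finite_cells by auto
      ultimately show False using over by simp
    qed
  qed
  show ?thesis
    unfolding game_bisimulation_def modified_game_def game.simps G(1) H(2)
  proof (intro conjI allI impI initial)
    fix P y assume con: "contracts n' P y"
    obtain f \<omega> where y: "y = (f, \<omega>)" by (cases y)
    note con = con[unfolded y]
    show "remaining ?G P = (case y of (f, \<omega>) \<Rightarrow> \<Sum>v\<in>verts ?H. \<omega> v)"
      using contracts_remaining[OF con] by (simp only: G H y prod.case)
    show "\<exists>y'. modified_turn ?H n' y y' \<and> contracts n' Q y'" if "turn ?G P Q" for Q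
      unfolding y by (rule stabilized_turn_contracts[OF con that])
    show "\<exists>Q. turn ?G P Q \<and> contracts n' Q y'" if "modified_turn ?H n' y y'" for y'
      by (rule modified_turn_contracts[OF con that[unfolded y]])
    show "completed ?G P = (case y of (f, \<omega>) \<Rightarrow> \<forall>v\<in>verts ?H. f v \<noteq> None)"
      if "remaining ?G P = 0 \<or> (\<nexists>Q. turn ?G P Q)"
      unfolding y prod.case by (rule completed_iff[OF con that])
  qed
qed

end

theorem lemma24:
  fixes ns :: "nat list" and n n' a b :: nat and \<Theta> :: isotopism and first :: player
  assumes "length ns \<ge> 2"
    and "\<forall>m\<in>set ns. m > 0" and "n > 0" and "a > 0" and "b > 0"
    and "\<Theta> \<in> isotopisms ns n"
    and "principal \<Theta>"
    and "feasible ns n \<Theta>"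
    and "n' \<ge> n"
  shows "alice_wins (stabilized_game ns n \<Theta> n') a b first \<longleftrightarrow>
         alice_wins (modified_game (orbit_contraction_graph ns \<Theta>) n') a b first"
proof -
  interpret feasible_principal_isotopism ns n \<Theta>
    using assms by unfold_locales
  show ?thesis
    using contracts_game_bisimulation assms(4,5) by (rule alice_wins_bisimulation)
qed

end
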